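(* Let $n$ be a positive integer and let $A=(a_{ij})$ be a real $n\times n$ matrix with $a_{ii}=0$ for all $i\in[n]$. The following are equivalent: (i) $A$ is a Kleene star; (ii) $C_A=\operatorname{span}(A)\cap\{x_n=0\}$.
   Context: Notation: $[n]=\{1,\dots,n\}$. Tropical operations on $\mathbb{R}$: $a\oplus b=\max\{a,b\}$ and $a\odot b=a+b$. All matrix products and powers are tropical: $(AB)_{ij}=\max_k (a_{ik}+b_{kj})$ and $A^2=AA$. Kleene star: a real $n\times n$ matrix $A$ with zero diagonal is called a Kleene star if $A=A^2$ (tropical product). Tropical column span: for a real $n\times m$ matrix $A$ with columns $a_1,\dots,a_m\in\mathbb{R}^n$, $$\operatorname{span}(A)=\{\max\{\lambda_1+a_1,\dots,\lambda_m+a_m\}\in\mathbb{R}^n:\ \lambda_1,\dots,\lambda_m\in\mathbb{R}\},$$ where $\lambda+a$ means adding the scalar $\lambda$ to every coordinate of $a$, and maxima are taken coordinatewise. The set $C_A$: for a real $n\times n$ matrix $A=(a_{ij})$ with zero diagonal, $$C_A=\{x\in\mathbb{R}^{n-1}:\ a_{in}\le x_i\le -a_{ni},\ \ a_{ik}\le x_i-x_k\le -a_{ki},\ \text{ for all } i,k\in[n-1],\ i\ne k\}$$ (possibly empty). Identification: $\mathbb{R}^{n-1}$ is identified with the hyperplane $\{x_n=0\}$ of $\mathbb{R}^n$ via $(x_1,\dots,x_{n-1})\mapsto(x_1,\dots,x_{n-1},0)$; thus $C_A$ is regarded as a subset of $\{x_n=0\}\subset\mathbb{R}^n$. *)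

theory Defs
  imports "Jordan_Normal_Form.Matrix"
begin

text \<open>Indices start at 0: the index set \<open>{1, ..., n}\<close> becomes \<open>{..<n}\<close>, so the last index
  is \<open>n - 1\<close>, and \<open>{1, ..., n - 1}\<close> becomes \<open>{..<n - 1}\<close>. The value of \<open>MAX\<close> over
  an empty index set is unspecified, so the following two definitions are meaningful only when
  the respective index set, \<open>{..<dim_col A}\<close>, is nonempty.\<close>

definition trop_mult :: "real mat \<Rightarrow> real mat \<Rightarrow> real mat"  (infixl "\<odot>" 70) where
  "A \<odot> B = mat (dim_row A) (dim_col B) (\<lambda>(i, j). MAX k\<in>{..<dim_col A}. A $$ (i, k) + B $$ (k, j))"

definition trop_span :: "real mat \<Rightarrow> real vec set" where
  "trop_span A = {vec (dim_row A) (\<lambda>i. MAX j\<in>{..<dim_col A}. l $ j + col A j $ i) | l.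
     l \<in> carrier_vec (dim_col A)}"

definition zero_diag :: "real mat \<Rightarrow> bool" where
  "zero_diag A \<longleftrightarrow> (\<forall>i<dim_row A. A $$ (i, i) = 0)"

definition kleene_star :: "real mat \<Rightarrow> bool" where
  "kleene_star A \<longleftrightarrow> square_mat A \<and> zero_diag A \<and> A = A \<odot> A"

text \<open>For an \<open>n\<close> by \<open>n\<close> matrix, a subset of the \<open>(n - 1)\<close>-dimensional space.\<close>

definition alcoved :: "real mat \<Rightarrow> real vec set" where
  "alcoved A = (let m = dim_row A - 1 in
     {x \<in> carrier_vec m.
        (\<forall>i<m. A $$ (i, m) \<le> x $ i \<and> x $ i \<le> - (A $$ (m, i))) \<and>
        (\<forall>i<m. \<forall>k<m. i \<noteq> k \<longrightarrow> A $$ (i, k) \<le> x $ i - x $ k \<and> x $ i - x $ k \<le> - (A $$ (k, i)))})"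

text \<open>The identification of \<open>(n - 1)\<close>-dimensional space with the hyperplane of vectors
  whose last coordinate is 0.\<close>

definition embed_last_zero :: "real vec \<Rightarrow> real vec" where
  "embed_last_zero x = x @\<^sub>v 0\<^sub>v 1"

definition last_zero_hyperplane :: "nat \<Rightarrow> real vec set" where
  "last_zero_hyperplane n = {x \<in> carrier_vec n. x $ (n - 1) = 0}"

end

theory Submission imports Defs begin

text \<open>After homogenisation, the points of \<open>alcoved A\<close> are the vectors \<open>y\<close> with last coordinate \<open>0\<close>
  satisfying the inequalities \<open>A $$ (i, k) + y $ k \<le> y $ i\<close> for all \<open>i\<close> and \<open>k\<close>, that is,
  \<open>A\<close> applied tropically to \<open>y\<close> is at most \<open>y\<close> (\<open>embed_alcoved\<close>). In the same way, since the
  diagonal is \<open>0\<close>, \<open>A\<close> is a Kleene star exactly when each of its columns satisfies these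
  inequalities (\<open>kleene_star_iff_triangle\<close>).

  Both implications follow. The inequalities always put \<open>y\<close> in the span, because the zero
  diagonal turns them into the fixed point equation that \<open>A\<close> applied to \<open>y\<close> is \<open>y\<close>
  (\<open>subsolution_in_trop_span\<close>); and they are preserved by tropical linear combinations, so
  they hold on the span once they hold for the columns
  (\<open>trop_span_subsolution\<close>). Conversely, each column, shifted so as to have last coordinate
  \<open>0\<close>, lies in the span (\<open>shifted_col_in_trop_span\<close>). So if the two sets agree, the columns
  satisfy the inequalities, and \<open>A\<close> is a Kleene star.\<close>

lemma MAX_lessThan_eqI:
  fixes f :: "nat \<Rightarrow> real"
  assumes "\<And>k. k < n \<Longrightarrow> f k \<le> c" and "j < n" and "f j = c"
  shows "(MAX k\<in>{..<n}. f k) = c"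
  using assms by (intro Max_eqI) auto

lemma MAX_lessThan_ge:
  fixes f :: "nat \<Rightarrow> real"
  assumes "j < n"
  shows "f j \<le> (MAX k\<in>{..<n}. f k)"
  using assms by (intro Max_ge) auto

lemma MAX_lessThan_attained:
  fixes f :: "nat \<Rightarrow> real"
  assumes "n > 0"
  obtains j where "j < n" and "(MAX k\<in>{..<n}. f k) = f j"
proof -
  have "(MAX k\<in>{..<n}. f k) \<in> f ` {..<n}"
    using assms by (intro Max_in) auto
  then show thesis
    using that by auto
qed

text \<open>The term \<open>k = j\<close> of the entry \<open>(i, j)\<close> of the square of \<open>A\<close> is the entry of \<open>A\<close> itself, so
  only the inequality from above is a condition.\<close>

lemma kleene_star_iff_triangle:
  assumes A: "A \<in> carrier_mat n n" and diag: "zero_diag A"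
  shows "kleene_star A \<longleftrightarrow>
    (\<forall>i<n. \<forall>k<n. \<forall>j<n. A $$ (i, k) + A $$ (k, j) \<le> A $$ (i, j))"
proof
  assume "kleene_star A"
  then have sq: "A = A \<odot> A"
    by (simp add: kleene_star_def)
  show "\<forall>i<n. \<forall>k<n. \<forall>j<n. A $$ (i, k) + A $$ (k, j) \<le> A $$ (i, j)"
  proof (intro allI impI)
    fix i k j assume ikj: "i < n" "k < n" "j < n"
    have "A $$ (i, k) + A $$ (k, j) \<le> (A \<odot> A) $$ (i, j)"
      using A ikj MAX_lessThan_ge[of k n "\<lambda>k. A $$ (i, k) + A $$ (k, j)"]
      by (simp add: trop_mult_def)
    then show "A $$ (i, k) + A $$ (k, j) \<le> A $$ (i, j)"
      using sq by simp
  qed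
next
  assume tri: "\<forall>i<n. \<forall>k<n. \<forall>j<n. A $$ (i, k) + A $$ (k, j) \<le> A $$ (i, j)"
  have "A = A \<odot> A"
  proof (rule eq_matI)
    fix i j assume "i < dim_row (A \<odot> A)" "j < dim_col (A \<odot> A)"
    then have ij: "i < n" "j < n"
      using A by (auto simp: trop_mult_def)
    have "(MAX k\<in>{..<n}. A $$ (i, k) + A $$ (k, j)) = A $$ (i, j)"
      using A diag ij tri by (intro MAX_lessThan_eqI[where j = j]) (auto simp: zero_diag_def)
    then show "A $$ (i, j) = (A \<odot> A) $$ (i, j)"
      using A ij by (simp add: trop_mult_def)
  qed (use A in \<open>auto simp: trop_mult_def\<close>)
  then show "kleene_star A"
    using A diag by (auto simp: kleene_star_def)
qed

text \<open>Each bound in \<open>alcoved A\<close> that involves one coordinate is a bound on its difference with the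
  last coordinate \<open>0\<close>, and each upper bound is the lower bound with the indices exchanged. So one
  family of inequalities remains, whose diagonal members hold trivially.\<close>

lemma embed_alcoved:
  assumes n: "n > 0" and A: "A \<in> carrier_mat n n" and diag: "zero_diag A"
  shows "embed_last_zero ` alcoved A =
    {y \<in> last_zero_hyperplane n. \<forall>i<n. \<forall>k<n. A $$ (i, k) + y $ k \<le> y $ i}"
proof (intro equalityI subsetI)
  obtain m where m: "n = Suc m"
    using n gr0_implies_Suc by blast
  {
    fix y assume "y \<in> embed_last_zero ` alcoved A"
    then obtain x where x: "x \<in> alcoved A" and y: "y = x @\<^sub>v 0\<^sub>v 1"
      by (auto simp: embed_last_zero_def)
    have xm: "x \<in> carrier_vec m"
      and one: "\<And>i. i < m \<Longrightarrow> A $$ (i, m) \<le> x $ i \<and> x $ i \<le> - A $$ (m, i)"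
      and two: "\<And>i k. i < m \<Longrightarrow> k < m \<Longrightarrow> i \<noteq> k \<Longrightarrow> A $$ (i, k) \<le> x $ i - x $ k"
      using x A m by (auto simp: alcoved_def Let_def)
    have low: "y $ i = x $ i" if "i < m" for i
      using that xm y by auto
    have last: "y $ m = 0"
      using xm y by auto
    have "A $$ (i, k) + y $ k \<le> y $ i" if ik: "i < n" "k < n" for i k
    proof -
      consider "i = k" | "i < m" "k < m" "i \<noteq> k" | "i < m" "k = m" | "i = m" "k < m"
        using ik m by (auto simp: less_Suc_eq)
      then show ?thesis
      proof cases
        case 1
        then show ?thesis using A diag ik by (auto simp: zero_diag_def)
      next
        case 2
        then show ?thesis using two[of i k] low by auto
      next
        case 3
        then show ?thesis using one[of i] low last by auto
      next
        case 4
        then show ?thesis using one[of k] low last by auto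
      qed
    qed
    moreover have "y \<in> last_zero_hyperplane n"
      using append_carrier_vec[OF xm zero_carrier_vec[of 1]] y last m
      by (simp add: last_zero_hyperplane_def)
    ultimately show "y \<in> {y \<in> last_zero_hyperplane n. \<forall>i<n. \<forall>k<n. A $$ (i, k) + y $ k \<le> y $ i}"
      by blast
  next
    fix y assume "y \<in> {y \<in> last_zero_hyperplane n. \<forall>i<n. \<forall>k<n. A $$ (i, k) + y $ k \<le> y $ i}"
    then have yn: "y \<in> carrier_vec n" and last: "y $ m = 0"
      and ineq: "\<And>i k. i < n \<Longrightarrow> k < n \<Longrightarrow> A $$ (i, k) + y $ k \<le> y $ i"
      using m by (auto simp: last_zero_hyperplane_def)
    define x where "x = vec m (($) y)"
    have one: "A $$ (i, m) \<le> x $ i \<and> x $ i \<le> - A $$ (m, i)" if "i < m" for i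
      using that ineq[of i m] ineq[of m i] last m by (auto simp: x_def)
    have two: "A $$ (i, k) \<le> x $ i - x $ k \<and> x $ i - x $ k \<le> - A $$ (k, i)"
      if "i < m" "k < m" for i k
      using that ineq[of i k] ineq[of k i] m by (auto simp: x_def)
    have "x \<in> alcoved A"
      using one two A m by (auto simp: alcoved_def Let_def x_def)
    moreover have "y = embed_last_zero x"
    proof (rule eq_vecI)
      fix i assume "i < dim_vec (embed_last_zero x)"
      then have "i < m \<or> i = m"
        by (auto simp: embed_last_zero_def x_def)
      then show "y $ i = embed_last_zero x $ i"
        using last by (auto simp: embed_last_zero_def x_def)
    qed (use yn m in \<open>auto simp: embed_last_zero_def x_def\<close>)
    ultimately show "y \<in> embed_last_zero ` alcoved A"
      by blast
  }
qed

lemma subsolution_in_trop_span: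
  assumes A: "A \<in> carrier_mat n n" and diag: "zero_diag A" and y: "y \<in> carrier_vec n"
    and ineq: "\<And>i k. i < n \<Longrightarrow> k < n \<Longrightarrow> A $$ (i, k) + y $ k \<le> y $ i"
  shows "y \<in> trop_span A"
proof -
  have "(MAX j\<in>{..<n}. y $ j + col A j $ i) = y $ i" if "i < n" for i
    using that A diag ineq[OF that]
    by (intro MAX_lessThan_eqI[where j = i]) (auto simp: zero_diag_def add.commute)
  then have "y = vec (dim_row A) (\<lambda>i. MAX j\<in>{..<dim_col A}. y $ j + col A j $ i)"
    using A y by (intro eq_vecI) auto
  then show ?thesis
    using A y by (auto simp: trop_span_def)
qed

text \<open>For a column chosen to attain the maximum in coordinate \<open>k\<close>, the triangle inequality bounds
  the left-hand side by the contribution of that same column to coordinate \<open>i\<close>.\<close>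

lemma trop_span_subsolution:
  assumes A: "A \<in> carrier_mat n n"
    and tri: "\<And>i k j. i < n \<Longrightarrow> k < n \<Longrightarrow> j < n \<Longrightarrow> A $$ (i, k) + A $$ (k, j) \<le> A $$ (i, j)"
    and y: "y \<in> trop_span A" and i: "i < n" and k: "k < n"
  shows "A $$ (i, k) + y $ k \<le> y $ i"
proof -
  obtain l where l: "y = vec n (\<lambda>i. MAX j\<in>{..<n}. l $ j + col A j $ i)"
    using A y by (auto simp: trop_span_def)
  have "n > 0"
    using i by simp
  then obtain j where j: "j < n" and "(MAX j\<in>{..<n}. l $ j + col A j $ k) = l $ j + col A j $ k"
    by (rule MAX_lessThan_attained)
  then have "A $$ (i, k) + y $ k = A $$ (i, k) + A $$ (k, j) + l $ j"
    using A k l by simp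
  also have "\<dots> \<le> l $ j + col A j $ i"
    using tri[OF i k j] A i j by simp
  also have "\<dots> \<le> y $ i"
    using MAX_lessThan_ge[OF j, of "\<lambda>j. l $ j + col A j $ i"] l i by simp
  finally show ?thesis .
qed

text \<open>Every column takes part in a tropical combination with a real coefficient, so the other
  columns cannot just be left out. Instead, column \<open>k\<close> gets the largest coefficient that keeps
  it below the target, which is the minimum below.\<close>

lemma shifted_col_in_trop_span:
  assumes A: "A \<in> carrier_mat n n" and j: "j < n"
  shows "vec n (\<lambda>i. c + A $$ (i, j)) \<in> trop_span A"
proof -
  define l where "l = vec n (\<lambda>k. MIN i\<in>{..<n}. c + A $$ (i, j) - A $$ (i, k))"
  have le: "l $ k + A $$ (i, k) \<le> c + A $$ (i, j)" if "i < n" "k < n" for i k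
  proof -
    have "(MIN i\<in>{..<n}. c + A $$ (i, j) - A $$ (i, k)) \<le> c + A $$ (i, j) - A $$ (i, k)"
      using that by (intro Min_le) auto
    moreover have "l $ k = (MIN i\<in>{..<n}. c + A $$ (i, j) - A $$ (i, k))"
      using that by (simp add: l_def)
    ultimately show ?thesis
      by linarith
  qed
  \<comment> \<open>For \<open>k = j\<close> the minimum is over a constant family.\<close>
  have "(\<lambda>i. c + A $$ (i, j) - A $$ (i, j)) ` {..<n} = {c}"
    using j by auto
  then have lj: "l $ j = c"
    using j by (simp add: l_def)
  have "(MAX k\<in>{..<n}. l $ k + col A k $ i) = c + A $$ (i, j)" if "i < n" for i
    using that A j le[OF that] lj by (intro MAX_lessThan_eqI[where j = j]) auto
  then have "vec n (\<lambda>i. c + A $$ (i, j)) =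
      vec (dim_row A) (\<lambda>i. MAX k\<in>{..<dim_col A}. l $ k + col A k $ i)"
    using A by (intro eq_vecI) auto
  moreover have "l \<in> carrier_vec (dim_col A)"
    using A by (simp add: l_def)
  ultimately show ?thesis
    by (auto simp: trop_span_def)
qed

theorem theorem1:
  fixes n :: nat and A :: "real mat"
  assumes "n > 0"
    and "A \<in> carrier_mat n n"
    and "zero_diag A"
  shows "kleene_star A \<longleftrightarrow> embed_last_zero ` alcoved A = trop_span A \<inter> last_zero_hyperplane n"
proof
  assume "kleene_star A"
  then have tri: "A $$ (i, k) + A $$ (k, j) \<le> A $$ (i, j)" if "i < n" "k < n" "j < n" for i k j
    using that kleene_star_iff_triangle[OF assms(2,3)] by blast
  have "y \<in> trop_span A \<longleftrightarrow> (\<forall>i<n. \<forall>k<n. A $$ (i, k) + y $ k \<le> y $ i)"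
    if "y \<in> last_zero_hyperplane n" for y
    using that subsolution_in_trop_span[OF assms(2,3), of y]
      trop_span_subsolution[OF assms(2) tri, of y]
    by (auto simp: last_zero_hyperplane_def)
  then show "embed_last_zero ` alcoved A = trop_span A \<inter> last_zero_hyperplane n"
    unfolding embed_alcoved[OF assms] by blast
next
  assume eq: "embed_last_zero ` alcoved A = trop_span A \<inter> last_zero_hyperplane n"
  have "A $$ (i, k) + A $$ (k, j) \<le> A $$ (i, j)" if ikj: "i < n" "k < n" "j < n" for i k j
  proof -
    define y where "y = vec n (\<lambda>i. - A $$ (n - 1, j) + A $$ (i, j))"
    have "y \<in> trop_span A"
      unfolding y_def by (rule shifted_col_in_trop_span[OF assms(2) ikj(3)])
    moreover have "y \<in> last_zero_hyperplane n"
      using assms(1) by (simp add: y_def last_zero_hyperplane_def)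
    ultimately have "A $$ (i, k) + y $ k \<le> y $ i"
      using ikj eq unfolding embed_alcoved[OF assms] by blast
    then show ?thesis
      using ikj by (simp add: y_def)
  qed
  then show "kleene_star A"
    using kleene_star_iff_triangle[OF assms(2,3)] by blast
qed

end
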